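(* Let $X \subset \mathbb{R}^d$ be a finite point set and $\gamma = \phi_X(\mu_X)/\phi^*$. Algorithm 1 (below) with sampling factor $\ell = k$, run for $t = O\left(\min\left(k, \frac{\log\gamma}{\log\log\gamma}\right)\right)$ sampling rounds, outputs a set of centers $C$ with $\phi_X(C) = O(\phi^* )$ (constant approximation ratio) with probability $1 - \exp(-\Omega(k^{0.1}))$.
   Context: For $x \in \mathbb{R}^d$ and finite nonempty $C \subset \mathbb{R}^d$, $d(x,C)=\min_{c\in C}\|x-c\|$; for finite $Y$, $\phi_Y(C)=\sum_{y\in Y} d^2(y,C)$, $\phi_x(C) = \phi_{\{x\}}(C)$, $\phi_Y(c)=\phi_Y(\{c\})$. $\mu_X$ is the centroid of $X$. $\phi^*$ is the optimal $k$-means cost $\min_{|C|=k}\phi_X(C)$. Algorithm 1 ($k$-means$||$ overseeding) with rounds $t$ and sampling factor $\ell$: sample $x\in X$ uniformly and set $C=\{x\}$; for $i=1,\dots,t$, include each $x \in X$ independently in $C'$ with probability $\min(1,\ell\phi_x(C)/\phi_X(C))$ and set $C\leftarrow C\cup C'$; return $C$. Standing assumptions: distinct points of $X$ are at distance at least $1$. *)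

theory Defs
  imports "HOL-Probability.Probability"
begin

text \<open>
  Points of \<open>\<real>\<^sup>d\<close> are sequences vanishing from index \<open>d\<close> on, so that \<open>d\<close> is an ordinary variable.
  With the dimension in a type, the type variable would be fixed before any existential quantifier
  over constants, and these could then depend on \<open>d\<close>.
\<close>

type_synonym point = "nat \<Rightarrow> real"

abbreviation Rd :: "nat \<Rightarrow> point set" where
  "Rd d \<equiv> topspace (Euclidean_space d)"

definition edist :: "nat \<Rightarrow> point \<Rightarrow> point \<Rightarrow> real" where
  "edist d x y = L2_set (\<lambda>i. x i - y i) {..<d}"

text \<open>Only meaningful for finite nonempty \<open>C\<close>; the same holds for the cost below.\<close>

definition dist_to :: "nat \<Rightarrow> point \<Rightarrow> point set \<Rightarrow> real" where
  "dist_to d x C = Min ((\<lambda>c. edist d x c) ` C)"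

definition cost :: "nat \<Rightarrow> point set \<Rightarrow> point set \<Rightarrow> real" where
  "cost d Y C = (\<Sum>y\<in>Y. (dist_to d y C)\<^sup>2)"

definition centroid :: "point set \<Rightarrow> point" where
  "centroid X = (\<lambda>i. (\<Sum>x\<in>X. x i) / real (card X))"

text \<open>
  Centers range over all of \<open>\<real>\<^sup>d\<close>. For \<open>d \<ge> 1\<close>, \<open>k \<ge> 1\<close> the infimum is over a nonempty set of
  nonnegative reals.
\<close>

definition opt_cost :: "nat \<Rightarrow> nat \<Rightarrow> point set \<Rightarrow> real" where
  "opt_cost d k X = Inf {cost d X C | C. C \<subseteq> Rd d \<and> finite C \<and> card C = k}"

definition gam :: "nat \<Rightarrow> nat \<Rightarrow> point set \<Rightarrow> real" where
  "gam d k X = cost d X {centroid X} / opt_cost d k X"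

text \<open>
  One round: the coins \<open>b x\<close>, for \<open>x \<in> X\<close>, are independent. Once the cost is 0, the division
  convention \<open>0 / 0 = 0\<close> makes a round add nothing.
\<close>

definition sampling_round :: "nat \<Rightarrow> real \<Rightarrow> point set \<Rightarrow> point set \<Rightarrow> point set pmf" where
  "sampling_round d l X C =
     map_pmf (\<lambda>b. C \<union> {x \<in> X. b x})
       (Pi_pmf X False (\<lambda>x. bernoulli_pmf (min 1 (l * cost d {x} C / cost d X C))))"

primrec kmeans_par :: "nat \<Rightarrow> real \<Rightarrow> point set \<Rightarrow> nat \<Rightarrow> point set pmf" where
  "kmeans_par d l X 0 = map_pmf (\<lambda>x. {x}) (pmf_of_set X)"
| "kmeans_par d l X (Suc t) = bind_pmf (kmeans_par d l X t) (sampling_round d l X)"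

text \<open>
  The quantity \<open>min (k, log \<gamma> / log log \<gamma>)\<close>. The quotient is negative for \<open>1 < \<gamma> < e\<close>, has a pole at
  \<open>\<gamma> = e\<close> and decreases to its minimum \<open>e\<close> at \<open>\<gamma> = e\<^sup>e\<close>, from where on it increases. As usual in an
  O-bound, it is replaced by a constant for small \<open>\<gamma>\<close>, namely by that minimum.
\<close>

definition round_bound :: "nat \<Rightarrow> real \<Rightarrow> real" where
  "round_bound k g =
     (let g' = max g (exp (exp 1)) in min (real k) (ln g' / ln (ln g')))"

end

theory Submission
  imports Defs "HOL-Real_Asymp.Real_Asymp"
begin

text \<open>
  Fix a clustering of \<open>X\<close> by centers \<open>S\<close> of nearly optimal cost, and call a cluster settled once
  its current cost is at most 34 times its cost under its center. An unsettled cluster of cost \<open>p\<close>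
  has a core, which carries at least \<open>p / 12\<close> of the current cost and any sampled point of which
  settles the cluster. So a round at total cost \<open>q\<close> misses a set of unsettled clusters with shares
  \<open>x\<^sub>c = k p\<^sub>c / (12 q)\<close> with probability at most \<open>exp (- \<Sum>x\<^sub>c)\<close>.

  This gives two bounds on the number of rounds. Some cluster is settled with constant probability
  in each round, so \<open>O(k)\<close> rounds suffice. Moreover, for every \<open>\<Lambda>\<close>, up to a probability
  \<open>exp (- k / (8 \<Lambda>))\<close>, a round settles \<open>k / (8 \<Lambda>)\<close> clusters if \<open>\<Sum>min x\<^sub>c 1 \<ge> k / \<Lambda>\<close>, and
  otherwise divides the unsettled cost by \<open>\<Lambda> / 96\<close>. With \<open>\<Lambda>\<close> of order \<open>(log \<gamma>)\<^bsup>1/4\<^esup>\<close>, the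
  first can happen \<open>O((log \<gamma>)\<^bsup>1/4\<^esup>)\<close> times and the second \<open>O(log \<gamma> / log log \<gamma>)\<close> times. Both
  bounds are turned into tail bounds by an exponential supermartingale.
\<close>

section \<open>Distances and costs\<close>

lemma edist_nonneg [simp]: "0 \<le> edist d x y"
  by (simp add: edist_def L2_set_nonneg)

lemma edist_commute: "edist d x y = edist d y x"
  by (simp add: edist_def L2_set_def power2_commute)

lemma edist_triangle: "edist d x z \<le> edist d x y + edist d y z"
  using L2_set_triangle_ineq[of "\<lambda>i. x i - y i" "\<lambda>i. y i - z i" "{..<d}"]
  by (simp add: edist_def)

lemma dist_to_singleton [simp]: "dist_to d x {c} = edist d x c"
  by (simp add: dist_to_def)

lemma dist_to_le: "finite C \<Longrightarrow> c \<in> C \<Longrightarrow> dist_to d x C \<le> edist d x c"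
  by (simp add: dist_to_def)

lemma dist_to_attained:
  assumes "finite C" "C \<noteq> {}"
  obtains c where "c \<in> C" "dist_to d x C = edist d x c"
proof -
  have "Min ((\<lambda>c. edist d x c) ` C) \<in> (\<lambda>c. edist d x c) ` C"
    using assms by (intro Min_in) auto
  thus ?thesis using that by (auto simp: dist_to_def)
qed

lemma dist_to_nonneg: "finite C \<Longrightarrow> C \<noteq> {} \<Longrightarrow> 0 \<le> dist_to d x C"
  by (erule (1) dist_to_attained[where x = x and d = d]) simp

lemma dist_to_antimono:
  "finite C' \<Longrightarrow> C \<subseteq> C' \<Longrightarrow> C \<noteq> {} \<Longrightarrow> dist_to d x C' \<le> dist_to d x C"
  unfolding dist_to_def by (intro Min_antimono) auto

lemma dist_to_triangle:
  assumes "finite C" "C \<noteq> {}"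
  shows "dist_to d x C \<le> edist d x y + dist_to d y C"
proof -
  obtain c where "c \<in> C" "dist_to d y C = edist d y c"
    using dist_to_attained[OF assms] .
  thus ?thesis
    using dist_to_le[OF assms(1), of c d x] edist_triangle[of d x c y] by linarith
qed

lemma cost_nonneg [simp]: "0 \<le> cost d Y C"
  by (simp add: cost_def sum_nonneg)

lemma cost_antimono:
  "finite C' \<Longrightarrow> C \<subseteq> C' \<Longrightarrow> C \<noteq> {} \<Longrightarrow> cost d Y C' \<le> cost d Y C"
  unfolding cost_def
  by (intro sum_mono power_mono dist_to_antimono dist_to_nonneg) (auto dest: finite_subset)

lemma square_add_le: "(a + b)\<^sup>2 \<le> 2 * a\<^sup>2 + 2 * (b :: real)\<^sup>2"
  using zero_le_power2[of "a - b"] by (simp add: power2_sum power2_diff)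

text \<open>Every point is routed to \<open>C\<close> through \<open>c\<close>; after squaring with
  \<open>square_add_le\<close>, the detour from \<open>c\<close> to \<open>C\<close> is paid once
  per point of \<open>A\<close>.\<close>

lemma cost_le_via_point:
  assumes "finite C" "C \<noteq> {}"
  shows "cost d A C \<le> 2 * cost d A {c} + 2 * (real (card A) * (dist_to d c C)\<^sup>2)"
proof -
  have "(dist_to d x C)\<^sup>2 \<le> 2 * (edist d x c)\<^sup>2 + 2 * (dist_to d c C)\<^sup>2" for x
    by (rule order_trans[OF power_mono[OF dist_to_triangle[OF assms, of d x c]] square_add_le])
       (rule dist_to_nonneg[OF assms])
  hence "cost d A C \<le> (\<Sum>x\<in>A. 2 * (edist d x c)\<^sup>2 + 2 * (dist_to d c C)\<^sup>2)"
    unfolding cost_def by (intro sum_mono)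
  thus ?thesis
    by (simp add: cost_def sum.distrib sum_distrib_left)
qed

section \<open>Cores of clusters\<close>

text \<open>The points whose squared distance to \<open>c\<close> is at most four times the average
  over \<open>A\<close>, multiplied out to avoid a division by the cardinality.\<close>

definition core :: "nat \<Rightarrow> point set \<Rightarrow> point \<Rightarrow> point set" where
  "core d A c = {x \<in> A. real (card A) * (edist d x c)\<^sup>2 \<le> 4 * cost d A {c}}"

lemma core_subset: "core d A c \<subseteq> A"
  by (auto simp: core_def)

text \<open>Routing through \<open>c\<close>, a core point serves \<open>A\<close> within the factor
  2 + 2 * 4 = 10. The weaker 34 is the threshold above which \<open>cost_le_core_cost\<close>
  applies.\<close>

lemma cost_le_if_core_hit:
  assumes "finite C" "x \<in> C" "x \<in> core d A c"
  shows "cost d A C \<le> 34 * cost d A {c}"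
proof -
  have "C \<noteq> {}" using assms by auto
  have "real (card A) * (dist_to d c C)\<^sup>2 \<le> real (card A) * (edist d x c)\<^sup>2"
    using dist_to_le[OF assms(1,2), of d c] dist_to_nonneg[OF assms(1) \<open>C \<noteq> {}\<close>, of d c]
    by (intro mult_left_mono power_mono) (auto simp: edist_commute)
  also have "\<dots> \<le> 4 * cost d A {c}"
    using assms(3) by (simp add: core_def)
  finally have "cost d A C \<le> 10 * cost d A {c}"
    using cost_le_via_point[OF assms(1) \<open>C \<noteq> {}\<close>, of d A c] by linarith
  thus ?thesis
    using cost_nonneg[of d A "{c}"] by linarith
qed

text \<open>Markov's inequality: a point outside the core has more than four times the average
  squared distance, so at most a quarter of \<open>A\<close> lies outside.\<close>

lemma card_core_ge:
  assumes "finite A"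
  shows "3 * real (card A) \<le> 4 * real (card (core d A c))"
proof (cases "cost d A {c} = 0")
  case True
  hence "\<forall>x\<in>A. (edist d x c)\<^sup>2 = 0"
    using assms by (simp add: cost_def sum_nonneg_eq_0_iff)
  hence "core d A c = A"
    unfolding core_def by (metis (no_types, lifting) Collect_cong Collect_mem_eq True mult_zero_right order_refl)
  thus ?thesis by simp
next
  case False
  define w where "w = cost d A {c}"
  have w: "0 < w" using False by (simp add: w_def order_less_le)
  let ?B = "A - core d A c"
  have "real (card ?B) * (4 * w) = (\<Sum>x\<in>?B. 4 * w)" by simp
  also have "\<dots> \<le> (\<Sum>x\<in>?B. real (card A) * (edist d x c)\<^sup>2)"
    by (intro sum_mono) (auto simp: core_def w_def)
  also have "\<dots> \<le> (\<Sum>x\<in>A. real (card A) * (edist d x c)\<^sup>2)"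
    using assms by (intro sum_mono2) auto
  also have "\<dots> = real (card A) * w"
    by (simp add: w_def cost_def sum_distrib_left)
  finally have "real (card ?B) * 4 \<le> real (card A)"
    using w by simp
  moreover have "card ?B = card A - card (core d A c)" "card (core d A c) \<le> card A"
    using assms core_subset[of d A c] finite_subset[OF core_subset assms, of d c]
    by (simp_all add: card_Diff_subset card_mono)
  ultimately show ?thesis by linarith
qed

text \<open>
  When \<open>C\<close> serves \<open>A\<close> badly, \<open>c\<close> is far from \<open>C\<close> compared with the radius of the core, so
  all core points have a distance to \<open>C\<close> comparable to that of \<open>c\<close>.
\<close>

lemma cost_le_core_cost:
  assumes "finite A" "finite C" "C \<noteq> {}" and unsettled: "34 * cost d A {c} < cost d A C"
  shows "cost d A C \<le> 12 * cost d (core d A c) C"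
proof -
  define n where "n = real (card A)"
  define w where "w = cost d A {c}"
  define D where "D = dist_to d c C"
  have D0: "0 \<le> D" using assms by (simp add: D_def dist_to_nonneg)
  have le: "cost d A C \<le> 2 * w + 2 * (n * D\<^sup>2)"
    unfolding n_def w_def D_def by (rule cost_le_via_point[OF assms(2,3)])
  \<comment> \<open>The threshold 34 = 2 + 2 * 16 is chosen for this bound, which puts the squared
    core radius 4 * w / n below (D / 2)^2.\<close>
  have w: "16 * w < n * D\<^sup>2"
    using le unsettled unfolding w_def by linarith
  have "A \<noteq> {}" using unsettled by (auto simp: cost_def)
  hence n: "0 < n" using assms(1) by (simp add: n_def card_gt_0_iff)
  have far: "(D / 2)\<^sup>2 \<le> (dist_to d x C)\<^sup>2" if "x \<in> core d A c" for x
  proof -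
    have "n * (edist d x c)\<^sup>2 \<le> n * (D / 2)\<^sup>2"
      using that w unfolding core_def n_def w_def power_divide by auto
    hence "(edist d x c)\<^sup>2 \<le> (D / 2)\<^sup>2" using n by simp
    hence "edist d x c \<le> D / 2" using D0 by (auto intro: power2_le_imp_le)
    moreover have "D \<le> edist d c x + dist_to d x C"
      unfolding D_def by (rule dist_to_triangle[OF assms(2,3)])
    ultimately have "D / 2 \<le> dist_to d x C" by (simp add: edist_commute)
    thus ?thesis using D0 by (intro power_mono) auto
  qed
  have "3 * n * (D / 2)\<^sup>2 \<le> 4 * real (card (core d A c)) * (D / 2)\<^sup>2"
    using card_core_ge[OF assms(1), of d c] by (intro mult_right_mono) (auto simp: n_def)
  also have "\<dots> = 4 * (\<Sum>x\<in>core d A c. (D / 2)\<^sup>2)" by simp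
  also have "\<dots> \<le> 4 * cost d (core d A c) C"
    unfolding cost_def by (intro mult_left_mono sum_mono far) auto
  finally have "3 * (n * D\<^sup>2) \<le> 16 * cost d (core d A c) C"
    by (simp add: power_divide)
  moreover have "0 \<le> w" by (simp add: w_def)
  \<comment> \<open>In total, 2 * w + 2 * n * D^2 is at most 17/8 * n * D^2, hence at most 34/3
    times the core cost; 34/3 is rounded up to 12.\<close>
  ultimately show ?thesis using le w by linarith
qed

section \<open>A single sampling round\<close>

text \<open>All independent coins on \<open>G\<close> must fail, and each factor 1 - min 1 u is at
  most exp (- u); where the cap 1 is active the factor is 0. Old centers in \<open>G\<close> only
  make the event rarer.\<close>

lemma prob_round_misses:
  assumes "finite X" "0 \<le> l" "G \<subseteq> X"
  shows "measure_pmf.prob (sampling_round d l X C) {C'. C' \<inter> G = {}}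
           \<le> exp (- (l * cost d G C / cost d X C))"
proof -
  let ?u = "\<lambda>x. l * cost d {x} C / cost d X C"
  let ?P = "Pi_pmf X False (\<lambda>x. bernoulli_pmf (min 1 (?u x)))"
  have u0: "0 \<le> ?u x" for x using assms(2) by simp
  have "measure_pmf.prob (sampling_round d l X C) {C'. C' \<inter> G = {}}
      = measure_pmf.prob ?P ((\<lambda>b. C \<union> {x \<in> X. b x}) -` {C'. C' \<inter> G = {}})"
    by (simp add: sampling_round_def)
  also have "\<dots> \<le> measure_pmf.prob ?P (Pi X (\<lambda>x. if x \<in> G then {False} else UNIV))"
    using assms(3) by (intro measure_pmf.finite_measure_mono) auto
  also have "\<dots> = (\<Prod>x\<in>X. measure_pmf.prob (bernoulli_pmf (min 1 (?u x)))
                               (if x \<in> G then {False} else UNIV))"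
    using assms(1) by (simp add: measure_Pi_pmf_Pi)
  also have "\<dots> = (\<Prod>x\<in>G. 1 - min 1 (?u x))"
    using assms u0 by (intro prod.mono_neutral_cong_right) (auto simp: measure_pmf_single)
  also have "\<dots> \<le> (\<Prod>x\<in>G. exp (- ?u x))"
  proof (intro prod_mono conjI)
    fix x
    show "1 - min 1 (?u x) \<le> exp (- ?u x)"
      using exp_ge_add_one_self[of "- ?u x"] by (cases "?u x \<le> 1") (auto simp: min_def)
  qed auto
  also have "\<dots> = exp (- (\<Sum>x\<in>G. ?u x))"
    using finite_subset[OF assms(3,1)] by (simp add: exp_sum flip: sum_negf)
  also have "(\<Sum>x\<in>G. ?u x) = l * cost d G C / cost d X C"
    by (simp add: cost_def sum_distrib_left sum_divide_distrib)
  finally show ?thesis .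
qed

lemma set_pmf_sampling_round:
  assumes "C' \<in> set_pmf (sampling_round d l X C)"
  shows "C \<subseteq> C'" "C' \<subseteq> C \<union> X"
  using assms by (auto simp: sampling_round_def)

section \<open>Exponential moments of dependent events\<close>

text \<open>Chernoff's bound, that is, Markov's inequality for \<open>exp (f z)\<close>. Finite
  support settles integrability.\<close>

lemma prob_le_exp_moment:
  fixes f :: "'a \<Rightarrow> real"
  assumes "finite (set_pmf p)" "measure_pmf.expectation p (\<lambda>z. exp (f z)) \<le> exp m"
  shows "measure_pmf.prob p {z. s \<le> f z} \<le> exp (m - s)"
proof -
  have int: "integrable (measure_pmf p) g" for g :: "'a \<Rightarrow> real"
    by (rule integrable_measure_pmf_finite[OF assms(1)])
  have "measure_pmf.prob p {z. s \<le> f z}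
      = measure_pmf.expectation p (indicator {z. s \<le> f z})"
    by simp
  also have "\<dots> \<le> measure_pmf.expectation p (\<lambda>z. exp (f z) * exp (- s))"
    by (intro integral_mono int) (auto simp: indicator_def exp_minus field_simps)
  also have "\<dots> \<le> exp m * exp (- s)"
    using assms(2) by simp
  finally show ?thesis by (simp add: exp_diff exp_minus field_simps)
qed

text \<open>
  Expanding the product over the subsets of \<open>I\<close> makes bounds on the joint probabilities a
  substitute for independence.
\<close>

lemma exp_moment_of_events:
  fixes E :: "'i \<Rightarrow> 'a set" and a q :: "'i \<Rightarrow> real"
  assumes "finite (set_pmf p)" "finite I"
    and a: "\<And>i. i \<in> I \<Longrightarrow> 0 \<le> a i"
    and joint: "\<And>J. J \<subseteq> I \<Longrightarrow> measure_pmf.prob p {z. \<forall>i\<in>J. z \<in> E i} \<le> (\<Prod>i\<in>J. q i)"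
  shows "measure_pmf.expectation p (\<lambda>z. exp (\<Sum>i\<in>I. a i * indicator (E i) z))
           \<le> (\<Prod>i\<in>I. 1 + (exp (a i) - 1) * q i)"
proof -
  have int: "integrable (measure_pmf p) g" for g :: "'a \<Rightarrow> real"
    by (rule integrable_measure_pmf_finite[OF assms(1)])
  let ?b = "\<lambda>i. exp (a i) - 1"
  have expand: "(\<Prod>i\<in>I. 1 + f i) = (\<Sum>J\<in>Pow I. \<Prod>i\<in>J. f i)" for f :: "'i \<Rightarrow> real"
    using prod_add[OF assms(2), of f "\<lambda>_. 1"] by (simp add: add.commute)
  have ind: "(\<Prod>i\<in>J. indicator (E i) z) = (indicator {z. \<forall>i\<in>J. z \<in> E i} z :: real)"
    if "finite J" for J z
    using that by induction (auto simp: indicator_def)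
  have "exp (\<Sum>i\<in>I. a i * indicator (E i) z)
      = (\<Sum>J\<in>Pow I. (\<Prod>i\<in>J. ?b i) * indicator {z. \<forall>i\<in>J. z \<in> E i} z)" for z
  proof -
    \<comment> \<open>Each factor is affine in its indicator: it is 1 off the event and exp (a i) on
      it.\<close>
    have "exp (\<Sum>i\<in>I. a i * indicator (E i) z) = (\<Prod>i\<in>I. 1 + ?b i * indicator (E i) z)"
      unfolding exp_sum[OF assms(2)] by (intro prod.cong refl) (auto simp: indicator_def)
    also have "\<dots> = (\<Sum>J\<in>Pow I. (\<Prod>i\<in>J. ?b i) * (\<Prod>i\<in>J. indicator (E i) z))"
      by (simp add: expand prod.distrib)
    also have "\<dots> = (\<Sum>J\<in>Pow I. (\<Prod>i\<in>J. ?b i) * indicator {z. \<forall>i\<in>J. z \<in> E i} z)"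
      using finite_subset[OF _ assms(2)] by (intro sum.cong refl) (simp add: ind)
    finally show ?thesis .
  qed
  hence "measure_pmf.expectation p (\<lambda>z. exp (\<Sum>i\<in>I. a i * indicator (E i) z))
      = (\<Sum>J\<in>Pow I. (\<Prod>i\<in>J. ?b i) * measure_pmf.prob p {z. \<forall>i\<in>J. z \<in> E i})"
    by (simp add: int)
  \<comment> \<open>The coefficients exp (a i) - 1 are nonnegative, so upper bounds on the joint
    probabilities suffice.\<close>
  also have "\<dots> \<le> (\<Sum>J\<in>Pow I. (\<Prod>i\<in>J. ?b i) * (\<Prod>i\<in>J. q i))"
    using a by (intro sum_mono mult_left_mono joint prod_nonneg) auto
  also have "\<dots> = (\<Prod>i\<in>I. 1 + ?b i * q i)"
    by (simp add: expand prod.distrib)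
  finally show ?thesis .
qed

text \<open>For counting missed clusters with weight 1: a cluster of share \<open>x\<close> lowers
  the exponent by a quarter of its truncated share.\<close>

lemma exp_moment_indicator_le:
  fixes x :: real
  assumes "0 \<le> x"
  shows "1 + (exp 1 - 1) * exp (- x) \<le> exp (1 - min x 1 / 4)"
proof -
  define m where "m = min x 1"
  have m: "0 \<le> m" "m \<le> 1" "m \<le> x" using assms by (auto simp: m_def)
  have e2: "2 \<le> exp (1 :: real)"
    using exp_ge_add_one_self[of "1 :: real"] by simp
  \<comment> \<open>On the unit interval, exp (- m) <= 1 / (1 + m) <= 1 - m / 2.\<close>
  have "exp (- m) * (1 + m) \<le> exp (- m) * exp m"
    using exp_ge_add_one_self[of m] by (intro mult_left_mono) auto
  also have "\<dots> = 1" by (simp flip: exp_add)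
  also have "1 \<le> (1 - m / 2) * (1 + m)"
    using m mult_left_mono[of m 1 m] by (simp add: algebra_simps)
  finally have "exp (- m) \<le> 1 - m / 2" using m by simp
  hence "exp (- x) \<le> 1 - m / 2" using m by (smt (verit) exp_le_cancel_iff)
  hence "(exp 1 - 1) * exp (- x) \<le> (exp 1 - 1) * (1 - m / 2)"
    using e2 by (intro mult_left_mono) auto
  moreover have "(exp 1 - 1) * (m / 2) \<ge> exp 1 / 2 * (m / 2)"
    using e2 m by (intro mult_right_mono) auto
  ultimately have "1 + (exp 1 - 1) * exp (- x) \<le> exp 1 * (1 - m / 4)"
    by (simp add: field_simps)
  also have "\<dots> \<le> exp 1 * exp (- (m / 4))"
    using exp_ge_add_one_self[of "- (m / 4)"] by (intro mult_left_mono) auto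
  finally show ?thesis by (simp add: m_def flip: exp_add)
qed

text \<open>For missed clusters weighted by half their share: the weight grows at half the rate at
  which the probability decays, so even a huge share contributes at most 1 to the exponent.\<close>

lemma exp_moment_half_le:
  fixes x :: real
  assumes "0 \<le> x"
  shows "1 + (exp (x / 2) - 1) * exp (- x) \<le> exp (min x 1)"
proof -
  define u where "u = exp (- (x / 2))"
  have u: "0 < u" "u \<le> 1" "1 - x / 2 \<le> u"
    using assms exp_ge_add_one_self[of "- (x / 2)"] by (auto simp: u_def)
  have "(exp (x / 2) - 1) * exp (- x) = u * (1 - u)"
    by (simp add: u_def algebra_simps flip: exp_add)
  also have "\<dots> \<le> min x 1"
    using u mult_right_mono[of u 1 "1 - u"] assms by (simp add: algebra_simps)
  finally show ?thesis
    using exp_ge_add_one_self[of "min x 1"] by linarith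
qed

section \<open>Potential functions along the rounds\<close>

lemma set_pmf_kmeans_par:
  assumes "finite X" "X \<noteq> {}" "C \<in> set_pmf (kmeans_par d l X t)"
  shows "C \<subseteq> X \<and> C \<noteq> {}"
  using assms(3)
proof (induction t arbitrary: C)
  case 0
  thus ?case using assms(1,2) by auto
next
  case (Suc t)
  then obtain C0 where C0: "C0 \<in> set_pmf (kmeans_par d l X t)"
    and C: "C \<in> set_pmf (sampling_round d l X C0)" by auto
  show ?case
    using Suc.IH[OF C0] set_pmf_sampling_round[OF C] by blast
qed

lemma finite_set_pmf_sampling_round:
  "finite X \<Longrightarrow> finite C \<Longrightarrow> finite (set_pmf (sampling_round d l X C))"
  by (rule finite_subset[of _ "Pow (C \<union> X)"]) (auto dest: set_pmf_sampling_round)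

text \<open>The one-step contraction is iterated. The states are the finitely many nonempty subsets
  of \<open>X\<close>, so expectations become finite sums.\<close>

lemma kmeans_par_expectation_decay:
  assumes "finite X" "X \<noteq> {}" "0 \<le> \<theta>"
    and init: "\<And>C. C \<subseteq> X \<Longrightarrow> C \<noteq> {} \<Longrightarrow> V C \<le> v"
    and step: "\<And>C. C \<subseteq> X \<Longrightarrow> C \<noteq> {} \<Longrightarrow>
      measure_pmf.expectation (sampling_round d l X C) V \<le> \<theta> * (V C :: real)"
  shows "measure_pmf.expectation (kmeans_par d l X t) V \<le> \<theta> ^ t * v"
proof -
  let ?S = "{C. C \<subseteq> X \<and> C \<noteq> {}}"
  have fin: "finite ?S" by (rule finite_subset[of _ "Pow X"]) (use assms(1) in auto)
  have sub: "set_pmf (kmeans_par d l X t) \<subseteq> ?S" for t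
    using set_pmf_kmeans_par[OF assms(1,2)] by blast
  have exp_eq: "measure_pmf.expectation (kmeans_par d l X t) h
      = (\<Sum>C\<in>?S. pmf (kmeans_par d l X t) C * h C)" for t and h :: "point set \<Rightarrow> real"
    using integral_measure_pmf[OF fin, of "kmeans_par d l X t" h] sub[of t] by auto
  show ?thesis
  proof (induction t)
    case 0
    have "measure_pmf.expectation (kmeans_par d l X 0) V
        \<le> (\<Sum>C\<in>?S. pmf (kmeans_par d l X 0) C * v)"
      unfolding exp_eq by (intro sum_mono mult_left_mono init) auto
    also have "\<dots> = (\<Sum>C\<in>?S. pmf (kmeans_par d l X 0) C) * v"
      by (simp add: sum_distrib_right)
    also have "(\<Sum>C\<in>?S. pmf (kmeans_par d l X 0) C) = 1"
      by (rule sum_pmf_eq_1[OF fin sub])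
    finally show ?case by simp
  next
    case (Suc t)
    have "measure_pmf.expectation (kmeans_par d l X (Suc t)) V
        = (\<Sum>C\<in>?S. pmf (kmeans_par d l X t) C *\<^sub>R
                     measure_pmf.expectation (sampling_round d l X C) V)"
      unfolding kmeans_par.simps
      by (intro pmf_expectation_bind[OF fin _ sub])
         (use assms(1) in \<open>auto intro!: finite_set_pmf_sampling_round dest: finite_subset\<close>)
    also have "\<dots> \<le> (\<Sum>C\<in>?S. pmf (kmeans_par d l X t) C * (\<theta> * V C))"
      by (auto intro!: sum_mono mult_left_mono step)
    also have "\<dots> = \<theta> * measure_pmf.expectation (kmeans_par d l X t) V"
      unfolding exp_eq by (simp add: sum_distrib_left mult_ac)
    also have "\<dots> \<le> \<theta> * (\<theta> ^ t * v)"
      using Suc.IH assms(3) by (intro mult_left_mono)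
    finally show ?case by (simp add: mult_ac)
  qed
qed

text \<open>The supermartingale is exp (r * \<open>\<Psi>\<close>) on bad states and 0 elsewhere. A
  round multiplies it by at most exp (- r) if the potential drops by 1 or badness ends; otherwise,
  with probability at most \<open>\<delta>\<close>, it does not grow. On bad states it is at least
  1.\<close>

lemma kmeans_par_bad_prob:
  fixes \<Psi> :: "point set \<Rightarrow> real" and bad :: "point set \<Rightarrow> bool"
  assumes X: "finite X" "X \<noteq> {}" and r0: "0 \<le> r" and "0 \<le> \<delta>"
    and range: "\<And>C. C \<subseteq> X \<Longrightarrow> C \<noteq> {} \<Longrightarrow> bad C \<Longrightarrow> 0 \<le> \<Psi> C \<and> \<Psi> C \<le> m"
    and mono: "\<And>C C'. C \<noteq> {} \<Longrightarrow> C \<subseteq> C' \<Longrightarrow> C' \<subseteq> X \<Longrightarrow> bad C' \<Longrightarrow> bad C \<and> \<Psi> C' \<le> \<Psi> C"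
    and drift: "\<And>C. C \<subseteq> X \<Longrightarrow> C \<noteq> {} \<Longrightarrow> bad C \<Longrightarrow>
      measure_pmf.prob (sampling_round d l X C) {C'. bad C' \<and> \<Psi> C - 1 < \<Psi> C'} \<le> \<delta>"
  shows "measure_pmf.prob (kmeans_par d l X t) {C. bad C}
           \<le> (exp (- r) + \<delta>) ^ t * exp (r * max m 0)"
proof -
  let ?V = "\<lambda>C. if bad C then exp (r * \<Psi> C) else 0"
  have fin: "finite (set_pmf (kmeans_par d l X t))"
    by (rule finite_subset[of _ "Pow X"]) (use X(1) in \<open>auto dest: set_pmf_kmeans_par[OF X]\<close>)
  have "measure_pmf.prob (kmeans_par d l X t) {C. bad C}
      = measure_pmf.expectation (kmeans_par d l X t) (indicator {C. bad C})"
    by simp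
  also have "\<dots> \<le> measure_pmf.expectation (kmeans_par d l X t) ?V"
  proof (intro integral_mono_AE integrable_measure_pmf_finite[OF fin] AE_pmfI)
    fix C assume "C \<in> set_pmf (kmeans_par d l X t)"
    thus "indicator {C. bad C} C \<le> ?V C"
      using set_pmf_kmeans_par[OF X] range[of C] r0 by (auto simp: indicator_def)
  qed
  also have "\<dots> \<le> (exp (- r) + \<delta>) ^ t * exp (r * max m 0)"
  proof (rule kmeans_par_expectation_decay[OF X])
    show "0 \<le> exp (- r) + \<delta>" using \<open>0 \<le> \<delta>\<close> by (simp add: add_nonneg_nonneg)
  next
    fix C assume "C \<subseteq> X" "C \<noteq> {}"
    thus "?V C \<le> exp (r * max m 0)"
      using range[of C] r0 by (auto intro!: mult_left_mono)
  next
    fix C assume C: "C \<subseteq> X" "C \<noteq> {}"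
    let ?R = "sampling_round d l X C"
    have finR: "finite (set_pmf ?R)"
      using X(1) C(1) by (auto intro: finite_set_pmf_sampling_round finite_subset)
    let ?E = "{C'. bad C' \<and> \<Psi> C - 1 < \<Psi> C'}"
    have up: "C \<subseteq> C'" "C' \<subseteq> X" if "C' \<in> set_pmf ?R" for C'
      using set_pmf_sampling_round[OF that] C by auto
    show "measure_pmf.expectation ?R ?V \<le> (exp (- r) + \<delta>) * ?V C"
    proof (cases "bad C")
      case False
      hence "\<not> bad C'" if "C' \<in> set_pmf ?R" for C'
        using mono[OF C(2) up[OF that]] by blast
      hence "measure_pmf.expectation ?R ?V = measure_pmf.expectation ?R (\<lambda>_. 0)"
        by (intro integral_cong_AE AE_pmfI) auto
      thus ?thesis using False by simp
    next
      case True
      let ?W = "\<lambda>C'. exp (r * \<Psi> C) * (exp (- r) + indicator ?E C')"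
      have "measure_pmf.expectation ?R ?V \<le> measure_pmf.expectation ?R ?W"
      proof (intro integral_mono_AE integrable_measure_pmf_finite[OF finR] AE_pmfI)
        fix C' assume C': "C' \<in> set_pmf ?R"
        consider "\<not> bad C'" | "bad C'" "C' \<in> ?E" | "bad C'" "C' \<notin> ?E" by blast
        thus "?V C' \<le> ?W C'"
        proof cases
          case 1
          thus ?thesis by simp
        next
          case 2
          have "exp (r * \<Psi> C') \<le> exp (r * \<Psi> C) * 1"
            using mono[OF C(2) up[OF C']] 2(1) r0 by (simp add: mult_left_mono)
          also have "\<dots> \<le> exp (r * \<Psi> C) * (exp (- r) + 1)"
            by (intro mult_left_mono) auto
          finally show ?thesis using 2 by simp
        next
          case 3
          hence "r * \<Psi> C' \<le> r * (\<Psi> C - 1)"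
            using r0 by (intro mult_left_mono) auto
          thus ?thesis using 3 by (simp add: algebra_simps flip: exp_add)
        qed
      qed
      also have "\<dots> = exp (r * \<Psi> C) * (exp (- r) + measure_pmf.prob ?R ?E)"
        by (simp add: integrable_measure_pmf_finite[OF finR])
      also have "\<dots> \<le> exp (r * \<Psi> C) * (exp (- r) + \<delta>)"
        using drift[OF C True] by (intro mult_left_mono) auto
      finally show ?thesis using True by (simp add: mult_ac)
    qed
  qed
  finally show ?thesis .
qed

section \<open>Clusters of a reference solution\<close>

text \<open>Fixing one nearest center per point breaks ties, so that the clusters partition
  \<open>X\<close>.\<close>

locale reference_clustering =
  fixes d k :: nat and X S :: "point set" and assign :: "point \<Rightarrow> point"
  assumes finX: "finite X" and X_nonempty: "X \<noteq> {}"
    and finS: "finite S" and cardS: "card S = k" and k_pos: "1 \<le> k"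
    and assign: "x \<in> X \<Longrightarrow> assign x \<in> S \<and> dist_to d x S = edist d x (assign x)"
begin

definition cluster :: "point \<Rightarrow> point set" where
  "cluster c = {x \<in> X. assign x = c}"

definition unsettled :: "point set \<Rightarrow> point set" where
  "unsettled C = {c \<in> S. 34 * cost d (cluster c) {c} < cost d (cluster c) C}"

definition ucost :: "point set \<Rightarrow> real" where
  "ucost C = (\<Sum>c\<in>unsettled C. cost d (cluster c) C)"

lemma cluster_subset: "cluster c \<subseteq> X"
  by (auto simp: cluster_def)

lemma finite_cluster: "finite (cluster c)"
  using finite_subset[OF cluster_subset finX] .

lemma unsettled_subset: "unsettled C \<subseteq> S"
  by (auto simp: unsettled_def)

lemma finite_unsettled: "finite (unsettled C)"
  using finite_subset[OF unsettled_subset finS] .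

lemma card_unsettled_le: "card (unsettled C) \<le> k"
  using card_mono[OF finS unsettled_subset] cardS by simp

lemma ucost_nonneg: "0 \<le> ucost C"
  by (simp add: ucost_def sum_nonneg)

lemma sum_cluster: "(\<Sum>c\<in>S. \<Sum>x\<in>cluster c. f x) = sum f X"
  unfolding cluster_def using assign by (intro sum.group finX finS) auto

lemma sum_cost_cluster: "(\<Sum>c\<in>S. cost d (cluster c) C) = cost d X C"
  unfolding cost_def by (rule sum_cluster)

lemma sum_cost_cluster_center: "(\<Sum>c\<in>S. cost d (cluster c) {c}) = cost d X S"
proof -
  have "(\<Sum>c\<in>S. cost d (cluster c) {c}) = (\<Sum>c\<in>S. \<Sum>x\<in>cluster c. (dist_to d x S)\<^sup>2)"
    unfolding cost_def by (intro sum.cong refl) (auto simp: cluster_def assign)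
  thus ?thesis by (simp add: sum_cluster cost_def)
qed

lemma cost_le_ucost: "cost d X C \<le> 34 * cost d X S + ucost C"
proof -
  have "cost d X C = (\<Sum>c\<in>S - unsettled C. cost d (cluster c) C) + ucost C"
    unfolding ucost_def sum_cost_cluster[symmetric]
    by (rule sum.subset_diff[OF unsettled_subset finS])
  moreover have "(\<Sum>c\<in>S - unsettled C. cost d (cluster c) C)
      \<le> (\<Sum>c\<in>S - unsettled C. 34 * cost d (cluster c) {c})"
    by (intro sum_mono) (auto simp: unsettled_def)
  moreover have "\<dots> \<le> (\<Sum>c\<in>S. 34 * cost d (cluster c) {c})"
    using finS by (intro sum_mono2) auto
  moreover have "\<dots> = 34 * cost d X S"
    by (simp add: sum_cost_cluster_center flip: sum_distrib_left)
  ultimately show ?thesis by linarith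
qed

lemma ucost_le_cost: "ucost C \<le> cost d X C"
  unfolding ucost_def sum_cost_cluster[symmetric]
  using unsettled_subset finS by (intro sum_mono2) auto

lemma unsettled_antimono:
  assumes "finite C'" "C \<subseteq> C'" "C \<noteq> {}"
  shows "unsettled C' \<subseteq> unsettled C"
  using cost_antimono[OF assms] by (force simp: unsettled_def intro: less_le_trans)

lemma ucost_antimono:
  assumes "finite C'" "C \<subseteq> C'" "C \<noteq> {}"
  shows "ucost C' \<le> ucost C"
proof -
  have "ucost C' \<le> (\<Sum>c\<in>unsettled C'. cost d (cluster c) C)"
    unfolding ucost_def by (intro sum_mono cost_antimono assms)
  also have "\<dots> \<le> ucost C"
    unfolding ucost_def using finite_unsettled unsettled_antimono[OF assms]
    by (intro sum_mono2) auto
  finally show ?thesis .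
qed

text \<open>A substitute for staying unsettled that depends only on which points were drawn, so that
  joint probabilities are accessible.\<close>

definition missed :: "point \<Rightarrow> point set set" where
  "missed c = {C. C \<inter> core d (cluster c) c = {}}"

lemma unsettled_missed: "finite C \<Longrightarrow> c \<in> unsettled C \<Longrightarrow> C \<in> missed c"
  using cost_le_if_core_hit[of C _ d "cluster c" c] by (force simp: unsettled_def missed_def)

end

section \<open>One round at high cost\<close>

text \<open>Since 70 > 2 * 34, settled clusters account for less than half of the current
  cost.\<close>

locale reference_clustering_round = reference_clustering +
  fixes C :: "point set"
  assumes CX: "C \<subseteq> X" and C_nonempty: "C \<noteq> {}"
    and costly: "70 * cost d X S < cost d X C"
begin

abbreviation next_centers :: "point set pmf" where
  "next_centers \<equiv> sampling_round d (real k) X C"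

text \<open>For an unsettled cluster, a lower bound on the sum of the uncapped sampling
  probabilities over its core; 12 is the loss in \<open>cost_le_core_cost\<close>.\<close>

definition share :: "point \<Rightarrow> real" where
  "share c = real k * cost d (cluster c) C / (12 * cost d X C)"

lemma finC: "finite C"
  using finite_subset[OF CX finX] .

lemma cost_pos: "0 < cost d X C"
  using costly cost_nonneg[of d X S] by linarith

lemma ucost_ge_half: "cost d X C \<le> 2 * ucost C"
  using cost_le_ucost[of C] costly cost_nonneg[of d X S] by linarith

lemma share_nonneg: "0 \<le> share c"
  by (simp add: share_def)

lemma finite_set_pmf_round: "finite (set_pmf next_centers)"
  by (rule finite_set_pmf_sampling_round[OF finX finC])

lemma round_superset:
  assumes "C' \<in> set_pmf next_centers"
  shows "C \<subseteq> C'" "finite C'" "unsettled C' \<subseteq> unsettled C"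
proof -
  show sub: "C \<subseteq> C'" using set_pmf_sampling_round[OF assms] by blast
  show fin: "finite C'"
    using set_pmf_sampling_round[OF assms] finC finX by (auto dest: finite_subset)
  show "unsettled C' \<subseteq> unsettled C"
    by (rule unsettled_antimono[OF fin sub C_nonempty])
qed

lemma prob_round_mono:
  "(\<And>C'. C' \<in> set_pmf next_centers \<Longrightarrow> C' \<in> A \<Longrightarrow> C' \<in> B) \<Longrightarrow>
   measure_pmf.prob next_centers A \<le> measure_pmf.prob next_centers B"
  by (intro measure_pmf.finite_measure_mono_AE AE_pmfI) auto

text \<open>Missing several cores means missing their union. The cores are disjoint, so their costs
  add up in the exponent and the bound becomes a product.\<close>

lemma prob_all_missed:
  assumes "J \<subseteq> unsettled C"
  shows "measure_pmf.prob next_centers {C'. \<forall>c\<in>J. C' \<in> missed c} \<le> (\<Prod>c\<in>J. exp (- share c))"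
proof -
  have finJ: "finite J" using finite_subset[OF assms finite_unsettled] .
  define G where "G = (\<Union>c\<in>J. core d (cluster c) c)"
  have fin_core: "finite (core d (cluster c) c)" for c
    using finite_subset[OF core_subset finite_cluster] .
  have "{C'. \<forall>c\<in>J. C' \<in> missed c} = {C'. C' \<inter> G = {}}"
    by (auto simp: missed_def G_def)
  moreover have "G \<subseteq> X"
    using core_subset cluster_subset unfolding G_def by blast
  ultimately have "measure_pmf.prob next_centers {C'. \<forall>c\<in>J. C' \<in> missed c}
      \<le> exp (- (real k * cost d G C / cost d X C))"
    using prob_round_misses[OF finX, of "real k" G d C] by simp
  also have "\<dots> \<le> exp (- (\<Sum>c\<in>J. share c))"
  proof -
    have "(\<Sum>c\<in>J. cost d (cluster c) C) \<le> (\<Sum>c\<in>J. 12 * cost d (core d (cluster c) c) C)"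
      using assms by (intro sum_mono cost_le_core_cost finite_cluster finC C_nonempty)
                     (auto simp: unsettled_def)
    also have "\<dots> = 12 * cost d G C"
      unfolding cost_def G_def sum_distrib_left[symmetric]
      by (subst sum.UNION_disjoint)
         (use finJ fin_core in \<open>auto simp: core_def cluster_def\<close>)
    finally have "real k * (\<Sum>c\<in>J. cost d (cluster c) C) / (12 * cost d X C)
        \<le> real k * (12 * cost d G C) / (12 * cost d X C)"
      using cost_pos by (intro divide_right_mono mult_left_mono) auto
    thus ?thesis
      by (simp add: share_def sum_distrib_left sum_divide_distrib)
  qed
  also have "\<dots> = (\<Prod>c\<in>J. exp (- share c))"
    using finJ by (simp add: exp_sum flip: sum_negf)
  finally show ?thesis .
qed

text \<open>If no cluster is settled, all unsettled cores are missed. Their shares sum to at least k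
  / 24, since unsettled clusters carry half of the cost.\<close>

lemma prob_no_cluster_settled:
  "measure_pmf.prob next_centers {C'. card (unsettled C) \<le> card (unsettled C')} \<le> exp (- (1 / 24))"
proof -
  have "measure_pmf.prob next_centers {C'. card (unsettled C) \<le> card (unsettled C')}
      \<le> measure_pmf.prob next_centers {C'. \<forall>c\<in>unsettled C. C' \<in> missed c}"
  proof (rule prob_round_mono)
    fix C' assume C': "C' \<in> set_pmf next_centers" "C' \<in> {C'. card (unsettled C) \<le> card (unsettled C')}"
    hence "unsettled C' = unsettled C"
      using card_seteq[OF finite_unsettled round_superset(3)[OF C'(1)]] by simp
    thus "C' \<in> {C'. \<forall>c\<in>unsettled C. C' \<in> missed c}"
      using unsettled_missed[OF round_superset(2)[OF C'(1)]] by auto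
  qed
  also have "\<dots> \<le> exp (- (\<Sum>c\<in>unsettled C. share c))"
    using prob_all_missed[OF order_refl] finite_unsettled by (simp add: exp_sum flip: sum_negf)
  also have "(\<Sum>c\<in>unsettled C. share c) = real k * ucost C / (12 * cost d X C)"
    by (simp add: share_def ucost_def sum_distrib_left sum_divide_distrib)
  also have "1 / 24 \<le> real k * ucost C / (12 * cost d X C)"
  proof -
    have "1 * cost d X C \<le> real k * (2 * ucost C)"
      using k_pos ucost_ge_half ucost_nonneg[of C] by (intro mult_mono) auto
    thus ?thesis using cost_pos by (simp add: field_simps)
  qed
  hence "exp (- (real k * ucost C / (12 * cost d X C))) \<le> exp (- (1 / 24))" by simp
  finally show ?thesis .
qed

text \<open>Both regimes of \<open>T\<close> use Chernoff's bound for missed clusters. If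
  \<open>T\<close> is large, too few settled clusters means that too many are missed; if
  \<open>T\<close> is small, too much remaining cost means that the missed clusters have too much
  total share.\<close>

lemma prob_no_progress:
  assumes "0 < \<Lambda>"
  shows "measure_pmf.prob next_centers
           {C'. card (unsettled C) - k / (8 * \<Lambda>) < card (unsettled C') \<and>
                96 / \<Lambda> * ucost C < ucost C'} \<le> exp (- (k / (8 * \<Lambda>)))"
    (is "measure_pmf.prob next_centers ?E \<le> _")
proof -
  let ?U = "unsettled C"
  define T where "T = (\<Sum>c\<in>?U. min (share c) 1)"
  have moment: "measure_pmf.expectation next_centers (\<lambda>C'. exp (\<Sum>c\<in>?U. a c * indicator (missed c) C'))
      \<le> (\<Prod>c\<in>?U. 1 + (exp (a c) - 1) * exp (- share c))"
    if "\<And>c. 0 \<le> a c" for a :: "point \<Rightarrow> real"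
    by (rule exp_moment_of_events[OF finite_set_pmf_round finite_unsettled that prob_all_missed])
  show ?thesis
  proof (cases "k / \<Lambda> \<le> T")
    case True
    let ?Z = "\<lambda>C'. \<Sum>c\<in>?U. 1 * indicator (missed c) C' :: real"
    have "measure_pmf.prob next_centers ?E
        \<le> measure_pmf.prob next_centers {C'. real (card ?U) - k / (8 * \<Lambda>) \<le> ?Z C'}"
    proof (rule prob_round_mono)
      fix C' assume C': "C' \<in> set_pmf next_centers" "C' \<in> ?E"
      have "real (card (unsettled C')) = (\<Sum>c\<in>unsettled C'. 1 * indicator (missed c) C')"
        using unsettled_missed[OF round_superset(2)[OF C'(1)]] by simp
      also have "\<dots> \<le> ?Z C'"
        using round_superset(3)[OF C'(1)] finite_unsettled by (intro sum_mono2) auto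
      finally show "C' \<in> {C'. real (card ?U) - k / (8 * \<Lambda>) \<le> ?Z C'}" using C'(2) by simp
    qed
    also have "\<dots> \<le> exp ((real (card ?U) - T / 4) - (real (card ?U) - k / (8 * \<Lambda>)))"
    proof (rule prob_le_exp_moment[OF finite_set_pmf_round order_trans[OF moment]])
      have "(\<Prod>c\<in>?U. 1 + (exp 1 - 1) * exp (- share c))
          \<le> (\<Prod>c\<in>?U. exp (1 - min (share c) 1 / 4))"
        by (intro prod_mono conjI exp_moment_indicator_le share_nonneg)
           (simp add: add_nonneg_nonneg)
      also have "\<dots> = exp (real (card ?U) - T / 4)"
        using finite_unsettled by (simp add: T_def sum_subtractf sum_divide_distrib flip: exp_sum)
      finally show "(\<Prod>c\<in>?U. 1 + (exp 1 - 1) * exp (- share c)) \<le> exp (real (card ?U) - T / 4)" .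
    qed simp
    \<comment> \<open>The exponent is k / (8 * \<open>\<Lambda>\<close>) - T / 4, and T / 4 is at
      least twice the first term.\<close>
    also have "\<dots> \<le> exp (- (k / (8 * \<Lambda>)))"
      using True assms by (simp add: field_simps)
    finally show ?thesis .
  next
    case False
    let ?Z = "\<lambda>C'. \<Sum>c\<in>?U. share c / 2 * indicator (missed c) C'"
    have "measure_pmf.prob next_centers ?E \<le> measure_pmf.prob next_centers {C'. 2 * (k / \<Lambda>) \<le> ?Z C'}"
    proof (rule prob_round_mono)
      fix C' assume C': "C' \<in> set_pmf next_centers" "C' \<in> ?E"
      have "k / (24 * cost d X C) * ucost C' \<le> (\<Sum>c\<in>unsettled C'. share c / 2 * indicator (missed c) C')"
        unfolding ucost_def sum_distrib_left
      proof (rule sum_mono)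
        fix c assume c: "c \<in> unsettled C'"
        have "k / (24 * cost d X C) * cost d (cluster c) C'
            \<le> k / (24 * cost d X C) * cost d (cluster c) C"
          using cost_pos round_superset[OF C'(1)] C_nonempty
          by (intro mult_left_mono cost_antimono) auto
        also have "\<dots> = share c / 2" by (simp add: share_def)
        finally show "k / (24 * cost d X C) * cost d (cluster c) C' \<le> share c / 2 * indicator (missed c) C'"
          using unsettled_missed[OF round_superset(2)[OF C'(1)] c] by simp
      qed
      also have "\<dots> \<le> ?Z C'"
        using round_superset(3)[OF C'(1)] finite_unsettled share_nonneg
        by (intro sum_mono2) auto
      finally have Z: "k / (24 * cost d X C) * ucost C' \<le> ?Z C'" .
      \<comment> \<open>The unsettled cost is at least half of the total, so the factor 96 becomes
        48. The 24 = 2 * 12 in half a share then leaves 48 / 24 = 2, twice the upper bound on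
        \<open>T\<close>.\<close>
      have "48 * cost d X C / \<Lambda> \<le> 96 / \<Lambda> * ucost C"
        using ucost_ge_half assms by (simp add: field_simps)
      also have "\<dots> \<le> ucost C'" using C'(2) by simp
      finally have "k / (24 * cost d X C) * (48 * cost d X C / \<Lambda>) \<le> k / (24 * cost d X C) * ucost C'"
        using cost_pos by (intro mult_left_mono) auto
      also have "k / (24 * cost d X C) * (48 * cost d X C / \<Lambda>) = 2 * (k / \<Lambda>)"
        using cost_pos assms by (simp add: field_simps)
      finally show "C' \<in> {C'. 2 * (k / \<Lambda>) \<le> ?Z C'}" using Z by simp
    qed
    also have "\<dots> \<le> exp (T - 2 * (k / \<Lambda>))"
    proof (rule prob_le_exp_moment[OF finite_set_pmf_round order_trans[OF moment]])
      have "(\<Prod>c\<in>?U. 1 + (exp (share c / 2) - 1) * exp (- share c))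
          \<le> (\<Prod>c\<in>?U. exp (min (share c) 1))"
        using share_nonneg by (intro prod_mono conjI exp_moment_half_le) (auto intro!: add_nonneg_nonneg)
      also have "\<dots> = exp T"
        using finite_unsettled by (simp add: T_def exp_sum)
      finally show "(\<Prod>c\<in>?U. 1 + (exp (share c / 2) - 1) * exp (- share c)) \<le> exp T" .
    qed (simp add: share_nonneg)
    also have "\<dots> \<le> exp (- (k / (8 * \<Lambda>)))"
      using False assms by (simp add: field_simps)
    finally show ?thesis .
  qed
qed

end

section \<open>Two tail bounds on the number of rounds\<close>

context reference_clustering
begin

text \<open>The potential is the number of unsettled clusters: at most \<open>k\<close> initially,
  and by \<open>prob_no_cluster_settled\<close> a round fails to lower it with probability at most
  exp (- 1 / 24).\<close>

lemma prob_costly_by_settling: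
  fixes r :: real
  assumes "0 \<le> r"
  shows "measure_pmf.prob (kmeans_par d (real k) X t) {C. 70 * cost d X S < cost d X C}
           \<le> (exp (- r) + exp (- (1 / 24))) ^ t * exp (r * k)"
proof -
  let ?bad = "\<lambda>C. 70 * cost d X S < cost d X C"
  have "measure_pmf.prob (kmeans_par d (real k) X t) {C. ?bad C}
      \<le> (exp (- r) + exp (- (1 / 24))) ^ t * exp (r * max (real k) 0)"
  proof (rule kmeans_par_bad_prob[OF finX X_nonempty assms, where \<Psi> = "\<lambda>C. real (card (unsettled C))"])
    fix C C' assume C: "C \<noteq> {}" "C \<subseteq> C'" "C' \<subseteq> X" "?bad C'"
    have fin: "finite C'" using C(3) finX by (rule finite_subset)
    show "?bad C \<and> real (card (unsettled C')) \<le> real (card (unsettled C))"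
      using cost_antimono[OF fin C(2,1), of d X] C(4)
        card_mono[OF finite_unsettled unsettled_antimono[OF fin C(2,1)]] by auto
  next
    fix C assume C: "C \<subseteq> X" "C \<noteq> {}" "?bad C"
    interpret reference_clustering_round d k X S assign C
      by unfold_locales (use C in auto)
    have "measure_pmf.prob next_centers
            {C'. ?bad C' \<and> real (card (unsettled C)) - 1 < real (card (unsettled C'))}
        \<le> measure_pmf.prob next_centers {C'. card (unsettled C) \<le> card (unsettled C')}"
      by (intro measure_pmf.finite_measure_mono) auto
    also note prob_no_cluster_settled
    finally show "measure_pmf.prob next_centers
        {C'. ?bad C' \<and> real (card (unsettled C)) - 1 < real (card (unsettled C'))}
      \<le> exp (- (1 / 24))" .
  qed (use card_unsettled_le in auto)
  thus ?thesis by simp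
qed

text \<open>
  The last summand of the potential pays for one round in which all of \<open>X\<close> is treated as a single
  cluster with center \<open>m\<close>; without it the initial cost could not be bounded in terms of \<open>g\<close>.
\<close>

lemma prob_costly_by_progress:
  fixes r L g :: real
  assumes r: "0 \<le> r" and L: "1 < L" and g: "1 \<le> g"
    and m: "cost d X {m} \<le> g * cost d X S" and base: "0 < cost d X S"
  shows "measure_pmf.prob (kmeans_par d (real k) X t) {C. 70 * cost d X S < cost d X C}
           \<le> (exp (- r) + exp (- (k / (768 * L)))) ^ t
               * exp (r * (ln (34 * g) / ln L + 768 * L + 1))"
proof -
  let ?b = "cost d X S"
  let ?bad = "\<lambda>C. 70 * ?b < cost d X C"
  let ?big = "\<lambda>C. 34 * cost d X {m} < cost d X C"
  \<comment> \<open>\<open>A\<close> counts the divisions of the unsettled cost by \<open>L\<close>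
    still possible, \<open>N\<close> the batches of k / (768 * L) clusters still to be settled. This
    is the progress of \<open>prob_no_progress\<close> for \<open>\<Lambda>\<close> = 96 * L, with
    768 = 8 * 96. The cap in \<open>A\<close> bounds it while \<open>?big\<close> holds.\<close>
  define A where "A C = min (ln (ucost C / ?b)) (ln (34 * g)) / ln L" for C
  define N where "N C = real (card (unsettled C)) * (768 * L / k)" for C
  define \<Psi> where "\<Psi> C = A C + N C + (if ?big C then 1 else 0)" for C
  have lnL: "0 < ln L" using L by simp
  have ln34g: "0 \<le> ln (34 * g)" using g by simp
  have ucost_gt: "?b < ucost C" if "?bad C" for C
    using cost_le_ucost[of C] that base by linarith
  have A_le: "A C \<le> ln (34 * g) / ln L" for C
    using lnL by (simp add: A_def divide_right_mono)
  have A_ge: "0 \<le> A C" if "?bad C" for C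
    using ucost_gt[OF that] base ln34g lnL by (simp add: A_def)
  have N_le: "N C \<le> 768 * L" for C
  proof -
    have "N C \<le> real k * (768 * L / k)"
      unfolding N_def using card_unsettled_le L by (intro mult_right_mono) auto
    thus ?thesis using k_pos by simp
  qed
  have N_ge: "0 \<le> N C" for C using L by (simp add: N_def)
  have mono: "?bad C \<and> \<Psi> C' \<le> \<Psi> C \<and> A C' \<le> A C \<and> N C' \<le> N C \<and> (?big C' \<longrightarrow> ?big C)"
    if C: "C \<noteq> {}" "C \<subseteq> C'" "C' \<subseteq> X" "?bad C'" for C C'
  proof -
    have fin: "finite C'" using C(3) finX by (rule finite_subset)
    have cost: "cost d X C' \<le> cost d X C" by (rule cost_antimono[OF fin C(2,1)])
    have "ln (ucost C' / ?b) \<le> ln (ucost C / ?b)"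
      using ucost_gt[OF C(4)] ucost_antimono[OF fin C(2,1)] base
      by (simp add: divide_right_mono)
    hence "A C' \<le> A C"
      unfolding A_def using lnL by (intro divide_right_mono min.mono) auto
    moreover have "N C' \<le> N C"
      unfolding N_def using L card_mono[OF finite_unsettled unsettled_antimono[OF fin C(2,1)]]
      by (intro mult_right_mono) auto
    ultimately show ?thesis using cost C(4) by (auto simp: \<Psi>_def)
  qed
  have "measure_pmf.prob (kmeans_par d (real k) X t) {C. ?bad C}
      \<le> (exp (- r) + exp (- (k / (768 * L)))) ^ t
          * exp (r * max (ln (34 * g) / ln L + 768 * L + 1) 0)"
  proof (rule kmeans_par_bad_prob[OF finX X_nonempty r, where \<Psi> = \<Psi>])
    fix C assume "?bad C"
    thus "0 \<le> \<Psi> C \<and> \<Psi> C \<le> ln (34 * g) / ln L + 768 * L + 1"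
      using A_ge[of C] A_le[of C] N_ge[of C] N_le[of C] by (simp add: \<Psi>_def)
  next
    fix C C' assume "C \<noteq> {}" "C \<subseteq> C'" "C' \<subseteq> X" "?bad C'"
    thus "?bad C \<and> \<Psi> C' \<le> \<Psi> C" using mono by blast
  next
    fix C assume C: "C \<subseteq> X" "C \<noteq> {}" "?bad C"
    interpret reference_clustering_round d k X S assign C
      by unfold_locales (use C in auto)
    let ?F = "{C'. ?bad C' \<and> \<Psi> C - 1 < \<Psi> C'}"
    have up: "C \<subseteq> C'" "C' \<subseteq> X" if "C' \<in> set_pmf next_centers" for C'
      using set_pmf_sampling_round[OF that] C by auto
    show "measure_pmf.prob next_centers ?F \<le> exp (- (k / (768 * L)))"
    proof (cases "?big C")
      case True
      \<comment> \<open>Since \<open>A\<close> and \<open>N\<close> never increase, a drop of less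
        than 1 means that \<open>?big\<close> persists, so the core of \<open>X\<close> around
        \<open>m\<close> was missed.\<close>
      have "measure_pmf.prob next_centers ?F
          \<le> measure_pmf.prob next_centers {C'. C' \<inter> core d X m = {}}"
      proof (rule prob_round_mono)
        fix C' assume C': "C' \<in> set_pmf next_centers" "C' \<in> ?F"
        have "?big C'"
          using mono[OF C(2) up[OF C'(1)]] C'(2) True by (auto simp: \<Psi>_def split: if_splits)
        thus "C' \<in> {C'. C' \<inter> core d X m = {}}"
          using cost_le_if_core_hit[OF round_superset(2)[OF C'(1)], of _ d X m] by force
      qed
      also have "\<dots> \<le> exp (- (real k * cost d (core d X m) C / cost d X C))"
        by (rule prob_round_misses[OF finX _ core_subset]) simp
      also have "\<dots> \<le> exp (- (k / (768 * L)))"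
      proof -
        have "k / (768 * L) \<le> k / 12"
          using L by (intro divide_left_mono) auto
        also have "\<dots> \<le> real k * cost d (core d X m) C / cost d X C"
          using cost_le_core_cost[OF finX finC C_nonempty True] cost_pos
          by (simp add: field_simps mult_left_mono)
        finally show ?thesis by simp
      qed
      finally show ?thesis .
    next
      case False
      \<comment> \<open>Once \<open>?big\<close> fails, the cap in \<open>A\<close> is
        inactive.\<close>
      have "ucost C \<le> 34 * g * ?b"
        using ucost_le_cost[of C] False m by (simp add: mult.assoc)
      hence "ln (ucost C / ?b) \<le> ln (34 * g)"
        using ucost_gt[OF C(3)] base g by (simp add: field_simps)
      hence A_eq: "A C = ln (ucost C / ?b) / ln L" by (simp add: A_def)
      define h where "h = 768 * L / k"
      have h: "0 < h" using L k_pos by (simp add: h_def)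
      have "measure_pmf.prob next_centers ?F \<le> measure_pmf.prob next_centers
           {C'. card (unsettled C) - k / (8 * (96 * L)) < card (unsettled C') \<and>
                96 / (96 * L) * ucost C < ucost C'}"
      proof (rule prob_round_mono)
        fix C' assume C': "C' \<in> set_pmf next_centers" "C' \<in> ?F"
        note mono' = mono[OF C(2) up[OF C'(1)]]
        have not_big: "\<not> ?big C'" using mono' C'(2) False by blast
        have AN: "A C + N C - 1 < A C' + N C'" "A C' \<le> A C" "N C' \<le> N C"
          using mono' C'(2) not_big False by (auto simp: \<Psi>_def)
        \<comment> \<open>Neither \<open>A\<close> nor \<open>N\<close> increases, so if their sum
          drops by less than 1, each of them does.\<close>
        have "N C - 1 < N C'" using AN by linarith
        hence "real (card (unsettled C)) * h < (real (card (unsettled C')) + 1 / h) * h"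
          using h by (simp add: N_def h_def[symmetric] distrib_right)
        hence "real (card (unsettled C)) < real (card (unsettled C')) + 1 / h"
          using h by (simp only: mult_less_cancel_right_pos)
        hence "real (card (unsettled C)) < real (card (unsettled C')) + k / (768 * L)"
          by (simp add: h_def)
        moreover have "ucost C < L * ucost C'"
        proof (rule ccontr)
          assume "\<not> ucost C < L * ucost C'"
          hence "L * (ucost C' / ?b) \<le> ucost C / ?b"
            using base by (simp add: field_simps)
          moreover have pos: "0 < ucost C' / ?b"
            using ucost_gt[of C'] C'(2) base by simp
          moreover have "0 < L * (ucost C' / ?b)"
            using pos L by (intro mult_pos_pos) auto
          ultimately have "ln (L * (ucost C' / ?b)) \<le> ln (ucost C / ?b)"
            by (metis ln_le_cancel_iff less_le_trans)
          moreover have "ln (L * (ucost C' / ?b)) = ln L + ln (ucost C' / ?b)"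
            using pos L by (intro ln_mult_pos) auto
          ultimately have "ln L + ln (ucost C' / ?b) \<le> ln (ucost C / ?b)" by simp
          moreover have "A C' \<le> ln (ucost C' / ?b) / ln L"
            unfolding A_def using lnL by (intro divide_right_mono) auto
          ultimately have "A C' \<le> A C - 1"
            unfolding A_eq using lnL by (simp add: field_simps)
          thus False using AN by linarith
        qed
        ultimately show "C' \<in> {C'. card (unsettled C) - k / (8 * (96 * L)) < card (unsettled C') \<and>
                96 / (96 * L) * ucost C < ucost C'}"
          using L by (simp add: field_simps)
      qed
      also have "\<dots> \<le> exp (- (k / (8 * (96 * L))))"
        by (rule prob_no_progress) (use L in simp)
      finally show ?thesis by simp
    qed
  qed simp
  moreover have "max (ln (34 * g) / ln L + 768 * L + 1) 0 = ln (34 * g) / ln L + 768 * L + 1"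
    using lnL ln34g L by (intro max_absorb1) (simp add: add_nonneg_nonneg)
  ultimately show ?thesis by simp
qed

end

section \<open>Near-optimal centers\<close>

text \<open>Ensures that sets of exactly \<open>k\<close> centers exist; the naturals are placed on
  the first axis.\<close>

lemma infinite_Rd:
  assumes "1 \<le> d"
  shows "infinite (Rd d)"
proof -
  have "inj (\<lambda>(n :: nat) i. if i = 0 then real n else 0 :: real)"
    by (auto simp: inj_def fun_eq_iff split: if_splits)
  moreover have "range (\<lambda>(n :: nat) i. if i = 0 then real n else 0 :: real) \<subseteq> Rd d"
    using assms by (auto simp: topspace_Euclidean_space)
  ultimately show ?thesis
    by (metis finite_imageD finite_subset infinite_UNIV_nat)
qed

lemma opt_cost_le: "C \<subseteq> Rd d \<Longrightarrow> finite C \<Longrightarrow> card C = k \<Longrightarrow> opt_cost d k X \<le> cost d X C"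
  unfolding opt_cost_def by (rule cInf_lower) (auto intro: bdd_belowI[of _ 0])

text \<open>A factor 2 of slack, strict because the optimum is positive, avoids proving that the
  infimum is attained.\<close>

lemma near_optimal_reference_clustering:
  assumes "1 \<le> d" "1 \<le> k" "finite X" "0 < opt_cost d k X"
  obtains S asg where "reference_clustering d k X S asg"
    "opt_cost d k X \<le> cost d X S" "cost d X S \<le> 2 * opt_cost d k X"
proof -
  let ?A = "{cost d X C | C. C \<subseteq> Rd d \<and> finite C \<and> card C = k}"
  have "?A \<noteq> {}"
    using infinite_arbitrarily_large[OF infinite_Rd[OF assms(1)], of k] by auto
  moreover have "Inf ?A < 2 * opt_cost d k X"
    using assms(4) by (simp add: opt_cost_def)
  ultimately obtain S where S: "S \<subseteq> Rd d" "finite S" "card S = k" "cost d X S < 2 * opt_cost d k X"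
    using cInf_lessD[of ?A] by blast
  have "S \<noteq> {}" using S(3) assms(2) by auto
  hence "\<forall>x. \<exists>c. c \<in> S \<and> dist_to d x S = edist d x c"
    by (meson dist_to_attained S(2))
  then obtain asg where "\<And>x. asg x \<in> S \<and> dist_to d x S = edist d x (asg x)"
    by metis
  moreover have "X \<noteq> {}"
    using S(4) opt_cost_le[OF S(1-3), of X] assms(4) by (auto simp: cost_def)
  ultimately have "reference_clustering d k X S asg"
    using S assms by unfold_locales auto
  thus ?thesis using that S(4) opt_cost_le[OF S(1-3), of X] by simp
qed

section \<open>Numerical estimates for the round count\<close>

lemma two_le_exp_one: "2 \<le> exp (1 :: real)"
  using exp_ge_add_one_self[of "1 :: real"] by simp

lemma one_le_div_ln:
  assumes "exp 1 \<le> (y :: real)"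
  shows "1 \<le> y / ln y"
proof -
  have y: "2 \<le> y" using two_le_exp_one assms by linarith
  have "1 \<le> ln y" using assms y by (simp add: ln_ge_iff)
  moreover have "ln y < y" by (rule ln_less_self) (use y in simp)
  ultimately show ?thesis by simp
qed

text \<open>The left side is the initial potential for L = y^(1/4) and y = ln g. Its three summands
  are bounded by 16, 1024 and 1 times y / ln y.\<close>

lemma rounds_for_quarter_power_le:
  fixes y :: real
  assumes "exp 1 \<le> y"
  shows "(ln 34 + y) / ln (y powr (1/4)) + 768 * y powr (1/4) + 1 \<le> 1041 * (y / ln y)"
proof -
  have y: "2 \<le> y" using two_le_exp_one assms by linarith
  have ln1: "1 \<le> ln y" using assms y by (simp add: ln_ge_iff)
  have "(34 :: real) \<le> 2 ^ 6" by simp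
  also have "\<dots> \<le> exp 1 ^ 6" using two_le_exp_one by (intro power_mono) auto
  also have "\<dots> = exp (6 :: real)" by (simp flip: exp_of_nat_mult)
  finally have "ln 34 \<le> ln (exp (6 :: real))" by (subst ln_le_cancel_iff) auto
  hence "ln 34 + y \<le> 4 * y" using y by simp
  hence "(ln 34 + y) / ln (y powr (1/4)) \<le> 4 * y / (ln y / 4)"
    using y ln1 by (simp add: ln_powr divide_right_mono)
  also have "\<dots> = 16 * (y / ln y)" by simp
  finally have 1: "(ln 34 + y) / ln (y powr (1/4)) \<le> 16 * (y / ln y)" .
  have "ln y \<le> y powr (3/4) / (3/4)"
    using y by (intro ln_powr_bound) auto
  hence "y powr (1/4) * ln y \<le> y powr (1/4) * (y powr (3/4) / (3/4))"
    by (intro mult_left_mono) auto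
  also have "\<dots> = 4 / 3 * y"
    using y by (simp flip: powr_add)
  finally have 2: "768 * y powr (1/4) \<le> 1024 * (y / ln y)"
    using ln1 by (simp add: field_simps)
  have 3: "1 \<le> y / ln y"
    by (rule one_le_div_ln[OF assms])
  show ?thesis using 1 2 3 by linarith
qed

text \<open>With z = y^(1/4), y <= k * ln y <= 2 * k * z^2 gives z <= sqrt (2 * k), and 768 * sqrt 2
  < 1088. Thus the failure exponent is of order sqrt k.\<close>

lemma quarter_power_le_sqrt:
  fixes y k :: real
  assumes "exp 1 \<le> y" "y / ln y \<le> k"
  shows "sqrt k / 1088 \<le> k / (768 * y powr (1/4))"
proof -
  have y: "2 \<le> y" using two_le_exp_one assms by linarith
  have ln1: "1 \<le> ln y" using assms y by (simp add: ln_ge_iff)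
  define z where "z = y powr (1/4)"
  have z: "0 < z" "y powr (1/2) = z\<^sup>2" "y = z ^ 4"
    using y by (auto simp: z_def powr_powr simp flip: powr_numeral)
  have k: "0 < k" using assms(2) y ln1 by (smt (verit) divide_pos_pos)
  have "y \<le> k * ln y" using assms(2) ln1 by (simp add: field_simps)
  also have "\<dots> \<le> k * (y powr (1/2) / (1/2))"
    using y k by (intro mult_left_mono ln_powr_bound) auto
  finally have "z\<^sup>2 * z\<^sup>2 \<le> (2 * k) * z\<^sup>2"
    unfolding z(2) using z(3) by (simp add: power2_eq_square power4_eq_xxxx mult_ac)
  hence "z\<^sup>2 \<le> 2 * k" using z(1) by (simp only: mult_le_cancel_right) simp
  hence "(768 * z)\<^sup>2 \<le> (1088 * sqrt k)\<^sup>2"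
    using k by (simp add: power_mult_distrib)
  hence "768 * z \<le> 1088 * sqrt k"
    by (rule power2_le_imp_le) (use k in simp)
  hence "sqrt k * (768 * z) \<le> sqrt k * (1088 * sqrt k)"
    using k by (intro mult_left_mono) auto
  also have "\<dots> = 1088 * k" using k by simp
  finally show ?thesis using z(1) by (simp add: z_def[symmetric] field_simps)
qed

lemma round_bound_eq:
  "round_bound k g = min (real k) (ln (max g (exp (exp 1))) / ln (ln (max g (exp (exp 1)))))"
  by (simp add: round_bound_def Let_def)

lemma ln_max_exp_ge: "exp 1 \<le> ln (max g (exp (exp (1 :: real))))"
  by (subst ln_ge_iff) (auto simp: less_max_iff_disj)

lemma geometric_decay_rounds:
  obtains r A :: real where "0 \<le> r" "0 < A"
    "\<And>(k :: nat) (t :: nat). A * k \<le> t \<Longrightarrow>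
      (exp (- r) + exp (- (1 / 24))) ^ t * exp (r * k) \<le> exp (- real k)"
proof -
  define e where "e = exp (- (1 / 24) :: real)"
  have e: "0 < e" "e < 1" by (auto simp: e_def)
  \<comment> \<open>This choice puts the base \<open>q\<close> halfway between \<open>e\<close> and
    1.\<close>
  define r where "r = - ln ((1 - e) / 2)"
  have exp_r: "exp (- r) = (1 - e) / 2" using e by (simp add: r_def)
  have r: "0 \<le> r" using e by (simp add: r_def)
  define q where "q = exp (- r) + e"
  have q: "0 < q" "q < 1" using e by (auto simp: q_def exp_r field_simps)
  \<comment> \<open>After A * k rounds, the power of \<open>q\<close> is at most exp (- (r + 1) *
    k), which absorbs exp (r * k) and leaves exp (- k).\<close>
  define A where "A = (r + 1) / - ln q"
  have lnq: "ln q < 0" using q by simp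
  have "q ^ t * exp (r * k) \<le> exp (- real k)" if "A * k \<le> t" for k t :: nat
  proof -
    have "A * k * - ln q \<le> t * - ln q"
      using that lnq by (intro mult_right_mono) auto
    moreover have "A * k * - ln q = (r + 1) * k" using lnq by (simp add: A_def)
    ultimately have "t * ln q + r * k \<le> - real k" by (simp add: algebra_simps)
    moreover have "q ^ t = exp (t * ln q)" using q by (simp add: exp_of_nat_mult)
    ultimately show ?thesis by (simp flip: exp_add)
  qed
  moreover have "0 < A" unfolding A_def using r lnq by (intro divide_pos_pos) auto
  ultimately show ?thesis using that r unfolding q_def e_def by blast
qed

text \<open>The initial factor exp (r * m) costs at most half of the rounds. The remaining exponent
  is t / 2 * (ln 4 - r), largest at t = 2.\<close>

lemma double_exp_power_le:
  fixes r m :: real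
  assumes "2 * m \<le> t" "2 \<le> t" "ln 4 \<le> r"
  shows "(exp (- r) + exp (- r)) ^ t * exp (r * m) \<le> 4 * exp (- r)"
proof -
  have r0: "0 \<le> r" using assms(3) ln_gt_zero[of "4 :: real"] by linarith
  have ln4: "ln 4 = 2 * ln (2 :: real)"
    using ln_realpow[of "2 :: real" 2] by simp
  have "exp (- r) + exp (- r) = exp (ln 2 - r)" by (simp add: exp_diff exp_minus field_simps)
  hence "(exp (- r) + exp (- r)) ^ t * exp (r * m) = exp (t * (ln 2 - r) + r * m)"
    by (simp add: exp_add exp_of_nat_mult)
  also have "t * (ln 2 - r) + r * m \<le> t * (ln 2 - r) + r * (t / 2)"
    using assms(1) r0 by (intro add_left_mono mult_left_mono) auto
  also have "\<dots> = t / 2 * (ln 4 - r)" by (simp add: ln4 algebra_simps)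
  also have "\<dots> \<le> 1 * (ln 4 - r)"
    using assms by (intro mult_right_mono_neg) auto
  finally have "(exp (- r) + exp (- r)) ^ t * exp (r * m) \<le> exp (ln 4 - r)" by simp
  thus ?thesis by (simp add: exp_diff exp_minus field_simps)
qed

section \<open>Combining the two bounds\<close>

theorem theorem3:
  shows "\<exists>A B c :: real. 0 < A \<and> 0 < B \<and> 0 < c \<and>
    (\<forall>(d :: nat) (k :: nat) (X :: point set).
       1 \<le> d \<longrightarrow> 1 \<le> k \<longrightarrow> finite X \<longrightarrow> X \<subseteq> Rd d \<longrightarrow>
       (\<forall>x\<in>X. \<forall>y\<in>X. x \<noteq> y \<longrightarrow> 1 \<le> edist d x y) \<longrightarrow>
       0 < opt_cost d k X \<longrightarrow>
       measure_pmf.prob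
         (kmeans_par d (real k) X (nat \<lceil>A * round_bound k (gam d k X)\<rceil>))
         {C. cost d X C \<le> B * opt_cost d k X}
       \<ge> 1 - exp (- c * real k powr 0.1))"
proof -
  obtain r A1 :: real where r: "0 \<le> r" "0 < A1"
    and decay: "\<And>(k :: nat) (t :: nat). A1 * k \<le> t \<Longrightarrow>
      (exp (- r) + exp (- (1 / 24))) ^ t * exp (r * k) \<le> exp (- real k)"
    using geometric_decay_rounds by blast
  \<comment> \<open>The second tail bound will give 4 * exp (- sqrt k / 1088); the exponent 0.1 <
    1/2 absorbs all constants for large \<open>k\<close>.\<close>
  have "eventually (\<lambda>k :: nat. 4 * exp (- (sqrt k / 1088)) \<le> exp (- (real k powr 0.1))) sequentially"
    by real_asymp
  moreover have "eventually (\<lambda>k :: nat. ln 4 \<le> sqrt k / 1088) sequentially"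
    by real_asymp
  ultimately have "eventually (\<lambda>k :: nat. 4 * exp (- (sqrt k / 1088)) \<le> exp (- (real k powr 0.1))
      \<and> ln 4 \<le> sqrt k / 1088) sequentially"
    by (rule eventually_conj)
  then obtain k1 :: nat where k1: "\<And>k. k1 \<le> k \<Longrightarrow>
      4 * exp (- (sqrt k / 1088)) \<le> exp (- (real k powr 0.1)) \<and> ln 4 \<le> sqrt k / 1088"
    unfolding eventually_sequentially by blast
  \<comment> \<open>\<open>A1\<close> serves the bound linear in \<open>k\<close>,
    \<open>A1 * k1\<close> the small \<open>k\<close>, where only a minimum of at least 1 is
    available, and 2082 = 2 * 1041 the logarithmic bound.\<close>
  define A where "A = A1 * (real k1 + 1) + 2082"
  have A: "A1 \<le> A" "A1 * real k1 \<le> A" "2082 \<le> A" "0 < A"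
    using r(2) by (auto simp: A_def algebra_simps add_pos_nonneg)
  show ?thesis
  \<comment> \<open>140 = 2 * 70, the 2 coming from the near-optimal centers.\<close>
  proof (rule exI[of _ A], rule exI[of _ 140], rule exI[of _ 1], intro conjI allI impI)
    fix d k :: nat and X :: "point set"
    assume dk: "1 \<le> d" "1 \<le> k" and X: "finite X" and opt: "0 < opt_cost d k X"
    obtain S asg where "reference_clustering d k X S asg"
      and S: "opt_cost d k X \<le> cost d X S" "cost d X S \<le> 2 * opt_cost d k X"
      using near_optimal_reference_clustering[OF dk X opt] .
    then interpret reference_clustering d k X S asg by simp
    define g where "g = max (gam d k X) (exp (exp 1))"
    define y where "y = ln g"
    have g: "1 \<le> g" by (simp add: g_def le_max_iff_disj)
    have y: "exp 1 \<le> y" unfolding y_def g_def by (rule ln_max_exp_ge)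
    have rb: "round_bound k (gam d k X) = min (real k) (y / ln y)"
      by (simp add: round_bound_eq y_def g_def)
    have ratio: "1 \<le> y / ln y" by (rule one_le_div_ln[OF y])
    define t where "t = nat \<lceil>A * round_bound k (gam d k X)\<rceil>"
    have t: "A * min (real k) (y / ln y) \<le> real t"
      unfolding t_def rb by (rule real_nat_ceiling_ge)
    let ?P = "kmeans_par d (real k) X t"
    have fail: "measure_pmf.prob ?P {C. 70 * cost d X S < cost d X C} \<le> exp (- (real k powr 0.1))"
    proof (cases "k < k1 \<or> real k < y / ln y")
      case True
      have "A1 * k \<le> A * min (real k) (y / ln y)"
      proof (cases "real k < y / ln y")
        case True
        thus ?thesis using A(1) by (simp add: mult_right_mono)
      next
        case False
        have "A1 * k \<le> A1 * k1"
          using \<open>k < k1 \<or> real k < y / ln y\<close> False r(2) by (intro mult_left_mono) auto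
        also have "\<dots> \<le> A * 1" using A(2) by simp
        also have "\<dots> \<le> A * min (real k) (y / ln y)"
          using A(4) ratio dk(2) by (intro mult_left_mono) auto
        finally show ?thesis .
      qed
      hence "A1 * k \<le> t" using t by linarith
      hence "measure_pmf.prob ?P {C. 70 * cost d X S < cost d X C} \<le> exp (- real k)"
        using prob_costly_by_settling[OF r(1), of t] decay[of k t] by linarith
      also have "real k powr 0.1 \<le> real k powr 1"
        using dk(2) by (intro powr_mono) auto
      hence "exp (- real k) \<le> exp (- (real k powr 0.1))" by simp
      finally show ?thesis .
    next
      case False
      define L where "L = y powr (1/4)"
      have y2: "2 \<le> y" using y two_le_exp_one by linarith
      have L: "1 < L" unfolding L_def using y2 by (intro gr_one_powr) auto
      \<comment> \<open>Taking the rate of the supermartingale equal to this failure exponent makes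
        both summands of the contraction factor equal.\<close>
      define s where "s = k / (768 * L)"
      have s: "sqrt k / 1088 \<le> s"
        unfolding s_def L_def by (rule quarter_power_le_sqrt[OF y]) (use False in simp)
      have k1': "4 * exp (- (sqrt k / 1088)) \<le> exp (- (real k powr 0.1))" "ln 4 \<le> sqrt k / 1088"
        using k1[of k] False by auto
      have t': "2082 * (y / ln y) \<le> t"
      proof -
        have "min (real k) (y / ln y) = y / ln y" using False by simp
        hence "A * (y / ln y) \<le> t" using t by simp
        moreover have "2082 * (y / ln y) \<le> A * (y / ln y)"
          using A(3) ratio by (intro mult_right_mono) linarith+
        ultimately show ?thesis by linarith
      qed
      have "cost d X {centroid X} = gam d k X * opt_cost d k X"
        using opt by (simp add: gam_def)
      also have "\<dots> \<le> g * cost d X S"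
        using S(1) opt g by (intro mult_mono) (auto simp: g_def)
      finally have m: "cost d X {centroid X} \<le> g * cost d X S" .
      have "measure_pmf.prob ?P {C. 70 * cost d X S < cost d X C}
          \<le> (exp (- s) + exp (- s)) ^ t * exp (s * (ln (34 * g) / ln L + 768 * L + 1))"
        using prob_costly_by_progress[OF _ L g m, of s t] opt S(1) L by (simp add: s_def)
      also have "\<dots> \<le> 4 * exp (- s)"
      proof (rule double_exp_power_le)
        have split: "ln (34 * g) = ln 34 + y" using g by (simp add: y_def ln_mult)
        have "2 * ((ln 34 + y) / ln L + 768 * L + 1) \<le> 2 * (1041 * (y / ln y))"
          by (intro mult_left_mono rounds_for_quarter_power_le[OF y, folded L_def]) simp
        also have "\<dots> = 2082 * (y / ln y)" by simp
        also note t'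
        finally show "2 * (ln (34 * g) / ln L + 768 * L + 1) \<le> t" unfolding split .
        show "2 \<le> t" using t' ratio by linarith
        show "ln 4 \<le> s" using s k1'(2) by linarith
      qed
      also have "\<dots> \<le> 4 * exp (- (sqrt k / 1088))" using s by simp
      also note k1'(1)
      finally show ?thesis .
    qed
    have "1 - measure_pmf.prob ?P {C. 70 * cost d X S < cost d X C}
        = measure_pmf.prob ?P (- {C. 70 * cost d X S < cost d X C})"
      using measure_pmf.prob_compl[of "{C. 70 * cost d X S < cost d X C}" ?P]
      by (simp add: Compl_eq_Diff_UNIV)
    also have "\<dots> \<le> measure_pmf.prob ?P {C. cost d X C \<le> 140 * opt_cost d k X}"
      using S(2) by (intro measure_pmf.finite_measure_mono) auto
    finally show "1 - exp (- 1 * real k powr 0.1)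
        \<le> measure_pmf.prob (kmeans_par d (real k) X (nat \<lceil>A * round_bound k (gam d k X)\<rceil>))
             {C. cost d X C \<le> 140 * opt_cost d k X}"
      using fail by (simp add: t_def)
  qed (use A in auto)
qed

end
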